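(* Let $d$ be a positive integer and let $\phi:\mathbb Z_+^d\to\mathbb R$ be a completely alternating function with Lévy measure $\nu$. For $i=1,\dots,d$ let $\phi^{(i)}:\mathbb Z_+\to\mathbb R$, $\phi^{(i)}(n)=\phi(n\varepsilon(i))$, be the $i$-th coordinate function of $\phi$, with Lévy measure $\nu^{(i)}$ on $[0,1)$. Then the following statements are equivalent: (i) for each $\alpha=(\alpha_1,\dots,\alpha_d)\in\mathbb Z_+^d$, $$\phi(\alpha)=\sum_{i=1}^d\phi^{(i)}(\alpha_i)-(d-1)\phi(0);$$ (ii) the Lévy measure $\nu$ for $\phi$ is of the form $$\nu=\sum_{i=1}^d\delta_1\times\cdots\times\underbrace{\nu^{(i)}}_{i\text{-th}}\times\cdots\times\delta_1,$$ where in the $i$-th summand the $i$-th factor is $\nu^{(i)}$ and all other factors are the Dirac measure $\delta_1$ at $1$ on $[0,1]$.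
   Context: $\mathbb Z_+$ is the set of nonnegative integers, $\mathbb R_+=[0,\infty)$, and $\varepsilon(i)\in\mathbb Z_+^d$ has $i$-th coordinate $1$ and all others $0$. For $\phi:\mathbb Z_+^d\to\mathbb R$ let $\nabla_i\phi(\alpha)=\phi(\alpha)-\phi(\alpha+\varepsilon(i))$ and $\nabla^\alpha=\nabla_1^{\alpha_1}\cdots\nabla_d^{\alpha_d}$. $\phi$ is completely alternating if $(\nabla^\alpha\phi)(\beta)\le0$ for all $\beta\in\mathbb Z_+^d$ and $\alpha\in\mathbb Z_+^d\setminus\{0\}$. It is known that $\phi$ is completely alternating if and only if there are $a\in\mathbb R$, an additive map $b:\mathbb Z_+^d\to\mathbb R_+$ and a positive Radon measure $\nu$ on $[0,1]^d\setminus\{\mathbf 1\}$, $\mathbf 1=(1,\dots,1)$, with $$\phi(\alpha)=a+b(\alpha)+\int_{[0,1]^d\setminus\{\mathbf 1\}}(1-x^\alpha)\,d\nu(x),\quad\alpha\in\mathbb Z_+^d\setminus\{0\},$$ where $a=\phi(0)$ and $b(\alpha)=\lim_{n\to\infty}\phi(n\alpha)/n$. The triple $(a,b,\nu)$ (the Lévy triple) is uniquely determined by $\phi$, and $\nu$ is called the Lévy measure for $\phi$. For completely alternating $\phi$ on $\mathbb Z_+^d$, each coordinate function $\phi^{(i)}$ is completely alternating on $\mathbb Z_+$, and $\nu^{(i)}$ is its Lévy measure (the case $d=1$, so on $[0,1)$). The $i$-th product measure lives on $[0,1]\times\cdots\times[0,1)\times\cdots\times[0,1]$ (with $[0,1)$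 in the $i$-th place) and is regarded as a measure on $[0,1]^d\setminus\{\mathbf 1\}$ by extending it by zero. *)

theory Defs
  imports "HOL-Probability.Probability"
begin

definition nabla :: "'d::finite \<Rightarrow> (nat^'d \<Rightarrow> real) \<Rightarrow> nat^'d \<Rightarrow> real" where
  "nabla i \<phi> = (\<lambda>\<alpha>. \<phi> \<alpha> - \<phi> (\<alpha> + axis i 1))"

(* The composition of the powers of the nabla i over all coordinates. The order of
   composition is irrelevant by the commutation lemma below, so the fold is well defined. *)
definition nabla_pow :: "nat^'d::finite \<Rightarrow> (nat^'d \<Rightarrow> real) \<Rightarrow> nat^'d \<Rightarrow> real" where
  "nabla_pow \<alpha> \<phi> = Finite_Set.fold (\<lambda>i. nabla i ^^ (\<alpha> $ i)) \<phi> UNIV"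

lemma comp_fun_commute_nabla_power:
  "comp_fun_commute (\<lambda>i. nabla i ^^ (\<alpha> $ i))"
proof -
  have comm: "nabla i (nabla j \<psi>) = nabla j (nabla i \<psi>)" for i j :: 'a and \<psi>
    by (rule ext) (simp add: nabla_def add.assoc add.commute[of "axis i (Suc 0)" "axis j (Suc 0)"])
  have 1: "(nabla i ^^ m) (nabla j \<psi>) = nabla j ((nabla i ^^ m) \<psi>)" for i j :: 'a and m \<psi>
    by (induction m) (simp_all add: comm[of i j])
  have "(nabla i ^^ m) ((nabla j ^^ n) \<psi>) = (nabla j ^^ n) ((nabla i ^^ m) \<psi>)"
    for i j :: 'a and m n \<psi>
    by (induction n) (simp_all add: 1)
  then show ?thesis
    by unfold_locales (simp add: fun_eq_iff)
qed

definition completely_alternating :: "(nat^'d::finite \<Rightarrow> real) \<Rightarrow> bool" where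
  "completely_alternating \<phi> \<longleftrightarrow>
     (\<forall>\<beta> \<alpha>. \<alpha> \<noteq> 0 \<longrightarrow> nabla_pow \<alpha> \<phi> \<beta> \<le> 0)"

definition radon_measure_on :: "'a::topological_space set \<Rightarrow> 'a measure \<Rightarrow> bool" where
  "radon_measure_on X M \<longleftrightarrow>
     sets M = sets (restrict_space borel X) \<and>
     (\<forall>K. compact K \<and> K \<subseteq> X \<longrightarrow> emeasure M K < \<infinity>) \<and>
     (\<forall>B\<in>sets M. emeasure M B = (SUP K\<in>{K. compact K \<and> K \<subseteq> B}. emeasure M K))"

abbreviation punctured_cube :: "(real^'d::finite) set" where
  "punctured_cube \<equiv> cbox 0 1 - {1}"

definition monom_at :: "real^'d::finite \<Rightarrow> nat^'d \<Rightarrow> real" where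
  "monom_at x \<alpha> = (\<Prod>i\<in>UNIV. (x $ i) ^ (\<alpha> $ i))"

(* The condition a = \<phi> 0 is part of the notion: the integral formula concerns only
   nonzero \<alpha>, hence does not determine a. *)
definition levy_triple ::
    "(nat^'d::finite \<Rightarrow> real) \<Rightarrow> real \<Rightarrow> (nat^'d \<Rightarrow> real) \<Rightarrow> (real^'d) measure \<Rightarrow> bool" where
  "levy_triple \<phi> a b \<nu> \<longleftrightarrow>
     (\<forall>\<alpha>. b \<alpha> \<ge> 0) \<and> (\<forall>\<alpha> \<beta>. b (\<alpha> + \<beta>) = b \<alpha> + b \<beta>) \<and>
     radon_measure_on punctured_cube \<nu> \<and>
     (\<forall>\<alpha>. \<alpha> \<noteq> 0 \<longrightarrow>
        integrable \<nu> (\<lambda>x. 1 - monom_at x \<alpha>) \<and>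
        \<phi> \<alpha> = a + b \<alpha> + (\<integral>x. (1 - monom_at x \<alpha>) \<partial>\<nu>)) \<and>
     a = \<phi> 0 \<and>
     (\<forall>\<alpha>. (\<lambda>n. \<phi> (n *s \<alpha>) / real n) \<longlonglongrightarrow> b \<alpha>)"

definition levy_measure :: "(nat^'d::finite \<Rightarrow> real) \<Rightarrow> (real^'d) measure \<Rightarrow> bool" where
  "levy_measure \<phi> \<nu> \<longleftrightarrow> (\<exists>a b. levy_triple \<phi> a b \<nu>)"

(* The case d = 1, for functions on nat and measures on [0,1): the general notion under
   the identifications of nat with nat^1 and of [0,1) with the punctured cube in real^1. *)
definition levy_measure_nat :: "(nat \<Rightarrow> real) \<Rightarrow> real measure \<Rightarrow> bool" where
  "levy_measure_nat f \<mu> \<longleftrightarrow>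
     sets \<mu> = sets (restrict_space borel {0..<1}) \<and>
     levy_measure (\<lambda>\<alpha>::nat^1. f (\<alpha> $ 1))
       (distr \<mu> (restrict_space borel punctured_cube) vec)"

definition coord_fun :: "(nat^'d::finite \<Rightarrow> real) \<Rightarrow> 'd \<Rightarrow> nat \<Rightarrow> real" where
  "coord_fun \<phi> i n = \<phi> (n *s axis i 1)"

(* The product measure lives on the functions x with x i in [0,1) and x j in [0,1] for
   j distinct from i; its image under the inclusion vec_lambda is its extension by zero. *)
definition coord_product :: "'d::finite \<Rightarrow> real measure \<Rightarrow> (real^'d) measure" where
  "coord_product i \<mu> =
     distr (PiM UNIV (\<lambda>j. if j = i then \<mu> else return (restrict_space borel {0..1}) 1))
       (restrict_space borel punctured_cube) vec_lambda"

definition sum_measures_on :: "'a measure \<Rightarrow> ('i::finite \<Rightarrow> 'a measure) \<Rightarrow> 'a measure" where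
  "sum_measures_on N M =
     measure_of (space N) (sets N) (\<lambda>A. \<Sum>i\<in>UNIV. emeasure (M i) A)"

end

(* The integral formula with \<alpha> and \<alpha> + axis i 1 in place of \<alpha> gives all moments of the measure
   (\<Sum>i. 1 - x $ i) d\<nu>, which is finite and lives on the cube; by Weierstrass approximation these
   moments determine it, and as the weight is positive off the point 1 they determine \<nu>. The sum of
   the product measures integrates 1 - x^\<alpha> to the sum of the integrals of 1 - t^(\<alpha> $ i) against the
   coordinate Levy measures, and the linear parts agree because b is additive and given by a limit;
   so (i) says precisely that \<nu> and this sum of product measures have the same moments. *)

theory Submission imports Defs
begin

section \<open>Finite Borel measures are determined by continuous functions\<close>

text \<open>The indicator of a nonempty closed set \<open>A\<close> is the pointwise limit of the
  continuous functions \<open>inverse (1 + infdist x A) ^ n\<close>, whose base is 1 on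
  \<open>A\<close> and below 1 off \<open>A\<close>. Dominated convergence then gives equality on
  closed sets, which form an intersection-stable generator of the Borel sets.\<close>

lemma finite_borel_measure_eqI:
  fixes F G :: "'a::metric_space measure"
  assumes "finite_measure F" "finite_measure G"
    and sets: "sets F = sets borel" "sets G = sets borel"
    and eq: "\<And>f :: 'a \<Rightarrow> real. continuous_on UNIV f \<Longrightarrow> (\<And>x. 0 \<le> f x \<and> f x \<le> 1) \<Longrightarrow>
      integral\<^sup>L F f = integral\<^sup>L G f"
  shows "F = G"
proof -
  interpret F: finite_measure F by fact
  interpret G: finite_measure G by fact
  have [measurable_cong]: "sets F = sets borel" "sets G = sets borel" by (fact sets)+
  have spc[simp]: "space F = UNIV" "space G = UNIV"
    using sets[THEN sets_eq_imp_space_eq] by simp_all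
  have closed_eq: "emeasure F A = emeasure G A" if "closed A" for A
  proof (cases "A = {}")
    case False
    \<comment> \<open>The empty set is treated apart because \<open>infdist x {}\<close> is 0 by
      convention, so that \<open>f n\<close> would be constantly 1 there.\<close>
    define f where "f n x = inverse (1 + infdist x A) ^ n" for n :: nat and x
    have cont: "continuous_on UNIV (f n)" for n
      unfolding f_def
      by (intro continuous_intros) (metis add_nonneg_eq_0_iff infdist_nonneg zero_le_one zero_neq_one)
    have meas[measurable]: "f n \<in> borel_measurable borel" for n
      using cont by (rule borel_measurable_continuous_onI)
    have bound: "0 \<le> f n x \<and> f n x \<le> 1" for n x
      unfolding f_def using infdist_nonneg[of x A]
      by (auto intro!: power_le_one simp: inverse_le_1_iff)
    have lim: "(\<lambda>n. f n x) \<longlonglongrightarrow> indicator A x" for x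
    proof (cases "x \<in> A")
      case True then show ?thesis by (simp add: f_def)
    next
      case out: False
      then have "infdist x A > 0"
        using \<open>closed A\<close> False in_closed_iff_infdist_zero[of A x] infdist_nonneg[of x A] by auto
      then have "\<bar>inverse (1 + infdist x A)\<bar> < 1" by (simp add: inverse_less_1_iff)
      then show ?thesis using out LIMSEQ_power_zero[of "inverse (1 + infdist x A)"] by (simp add: f_def)
    qed
    have A[measurable]: "A \<in> sets borel" using that by simp
    have "(\<lambda>n. integral\<^sup>L F (f n)) \<longlonglongrightarrow> integral\<^sup>L F (indicator A :: 'a \<Rightarrow> real)"
      by (rule integral_dominated_convergence[where w = "\<lambda>_. 1"]) (use lim bound in auto)
    moreover have "(\<lambda>n. integral\<^sup>L G (f n)) \<longlonglongrightarrow> integral\<^sup>L G (indicator A :: 'a \<Rightarrow> real)"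
      by (rule integral_dominated_convergence[where w = "\<lambda>_. 1"]) (use lim bound in auto)
    moreover have "integral\<^sup>L F (f n) = integral\<^sup>L G (f n)" for n
      using eq[OF cont bound] .
    ultimately have "measure F A = measure G A"
      using LIMSEQ_unique by fastforce
    then show ?thesis by (simp add: F.emeasure_eq_measure G.emeasure_eq_measure)
  qed simp
  show ?thesis
  proof (rule measure_eqI_generator_eq[where E = "Collect closed" and \<Omega> = UNIV and A = "\<lambda>_. UNIV"])
    show "Int_stable (Collect closed :: 'a set set)" by (auto simp: Int_stable_def)
  qed (use closed_eq sets F.emeasure_finite in \<open>auto simp: borel_eq_closed\<close>)
qed

section \<open>Monomials on the unit cube\<close>

lemma monom_at_add: "monom_at x (\<alpha> + \<beta>) = monom_at x \<alpha> * monom_at x \<beta>"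
  by (simp add: monom_at_def power_add prod.distrib)

lemma monom_at_axis: "monom_at x (n *s axis i 1) = x $ i ^ n"
proof -
  have "monom_at x (n *s axis i 1) = (\<Prod>j\<in>UNIV. if j = i then x $ i ^ n else 1)"
    unfolding monom_at_def by (intro prod.cong) (auto simp: axis_def)
  then show ?thesis by simp
qed

lemma monom_at_zero [simp]: "monom_at x 0 = 1"
  by (simp add: monom_at_def)

lemma continuous_on_monom_at: "continuous_on S (\<lambda>x. monom_at x \<alpha>)"
  unfolding monom_at_def by (intro continuous_intros)

lemma monom_at_measurable [measurable]: "(\<lambda>x. monom_at x \<alpha>) \<in> borel_measurable borel"
  using continuous_on_monom_at by (rule borel_measurable_continuous_onI)

lemma mem_unit_cbox: "x \<in> cbox 0 1 \<longleftrightarrow> (\<forall>i. 0 \<le> x $ i \<and> x $ i \<le> 1)" for x :: "real^'d::finite"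
  by (simp add: mem_box_cart)

lemma monom_at_unit:
  assumes "x \<in> cbox 0 1"
  shows "0 \<le> monom_at x \<alpha>" "monom_at x \<alpha> \<le> 1"
  using assms unfolding monom_at_def mem_unit_cbox
  by (auto intro!: prod_nonneg prod_le_1 power_le_one)

section \<open>Moments determine a finite measure on the cube\<close>

text \<open>Induction on the construction of \<open>p\<close>. The extra factors, a monomial and an
  arbitrary continuous \<open>f\<close>, make the induction close: a linear \<open>p\<close> only
  shifts the exponent \<beta>, and for a product \<open>p * q\<close> the factor \<open>q\<close> is
  absorbed into \<open>f\<close>.\<close>

lemma real_polynomial_function_moments:
  fixes F G :: "(real^'d::finite) measure"
  assumes int: "\<And>f :: real^'d \<Rightarrow> real. continuous_on UNIV f \<Longrightarrow> integrable F f \<and> integrable G f"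
    and p: "real_polynomial_function p"
    and f: "continuous_on UNIV f"
    and eq: "\<And>\<beta>. (\<integral>x. monom_at x \<beta> * f x \<partial>F) = (\<integral>x. monom_at x \<beta> * f x \<partial>G)"
  shows "(\<integral>x. monom_at x \<beta> * (p x * f x) \<partial>F) = (\<integral>x. monom_at x \<beta> * (p x * f x) \<partial>G)"
  using p f eq
proof (induction arbitrary: f \<beta> rule: real_polynomial_function.induct)
  case (linear h)
  have h: "h x = (\<Sum>i\<in>UNIV. h (axis i 1) * x $ i)" for x
  proof -
    have "h x = h (\<Sum>i\<in>UNIV. x $ i *s axis i 1)" by (simp add: basis_expansion)
    also have "\<dots> = (\<Sum>i\<in>UNIV. x $ i * h (axis i 1))"
      using bounded_linear.linear[OF linear(1)]
      by (simp add: linear_sum scalar_mult_eq_scaleR linear_scale)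
    finally show ?thesis by (simp add: mult.commute)
  qed
  \<comment> \<open>Multiplication by \<open>x $ i\<close> raises the exponent \<beta> by
    \<open>axis i 1\<close>; it is written \<open>1 *s axis i 1\<close> so that
    \<open>monom_at_axis\<close> applies.\<close>
  have *: "monom_at x \<beta> * (h x * f x) =
      (\<Sum>i\<in>UNIV. h (axis i 1) * (monom_at x (\<beta> + 1 *s axis i 1) * f x))" for x
    unfolding h[of x] monom_at_add monom_at_axis sum_distrib_left sum_distrib_right
    by (intro sum.cong) (simp_all add: ac_simps)
  have "integrable F (\<lambda>x. h (axis i 1) * (monom_at x (\<beta> + 1 *s axis i 1) * f x)) \<and>
        integrable G (\<lambda>x. h (axis i 1) * (monom_at x (\<beta> + 1 *s axis i 1) * f x))" for i
    by (intro int continuous_intros continuous_on_monom_at linear.prems(1))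
  then show ?case
    unfolding * by (simp add: linear.prems(2))
next
  case (const c)
  then show ?case by (simp add: mult.left_commute[of _ c])
next
  case (add p q)
  have p: "continuous_on UNIV p" "continuous_on UNIV q"
    using add.hyps by (auto intro: continuous_on_polymonial_function simp: real_polynomial_function_eq)
  have "continuous_on UNIV (\<lambda>x. monom_at x \<beta> * (p x * f x))"
       "continuous_on UNIV (\<lambda>x. monom_at x \<beta> * (q x * f x))"
    by (intro continuous_intros continuous_on_monom_at p add.prems(1))+
  note this[THEN int]
  then show ?case
    using add.IH add.prems by (simp add: algebra_simps)
next
  case (mult p q)
  have q: "continuous_on UNIV q"
    using mult.hyps by (auto intro: continuous_on_polymonial_function simp: real_polynomial_function_eq)
  \<comment> \<open>The hypothesis for \<open>p\<close> is used with \<open>q x * f x\<close> in the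
    role of \<open>f\<close>; its moments agree by the hypothesis for \<open>q\<close>.\<close>
  have "(\<integral>x. monom_at x \<beta> * (p x * (q x * f x)) \<partial>F) = (\<integral>x. monom_at x \<beta> * (p x * (q x * f x)) \<partial>G)"
    by (rule mult.IH(1)) (auto intro!: continuous_intros q mult)
  then show ?case by (simp add: mult.assoc)
qed

text \<open>Equal moments give equal integrals of all polynomials. A continuous function is bounded
  on the compact cube, which carries both measures, and is there a uniform limit of polynomials, so
  its integrals agree as well.\<close>

lemma measure_eqI_moments:
  fixes F G :: "(real^'d::finite) measure"
  assumes "finite_measure F" "finite_measure G"
    and sets: "sets F = sets borel" "sets G = sets borel"
    and cube: "AE x in F. x \<in> cbox 0 1" "AE x in G. x \<in> cbox 0 1"
    and moments: "\<And>\<beta>. (\<integral>x. monom_at x \<beta> \<partial>F) = (\<integral>x. monom_at x \<beta> \<partial>G)"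
  shows "F = G"
proof -
  interpret F: finite_measure F by fact
  interpret G: finite_measure G by fact
  have [measurable_cong]: "sets F = sets borel" "sets G = sets borel" by (fact sets)+
  have int: "integrable F f \<and> integrable G f" if "continuous_on UNIV f" for f :: "_ \<Rightarrow> real"
  proof -
    have [measurable]: "f \<in> borel_measurable borel"
      using that by (rule borel_measurable_continuous_onI)
    have "compact (f ` cbox 0 1)"
      using that by (intro compact_continuous_image) (auto intro: continuous_on_subset)
    then have "bounded (f ` cbox 0 1)" by (rule compact_imp_bounded)
    then obtain B where B: "\<And>x. x \<in> cbox 0 1 \<Longrightarrow> norm (f x) \<le> B"
      unfolding bounded_iff by auto
    show ?thesis
      using cube
      by (intro conjI F.integrable_const_bound[where B = B] G.integrable_const_bound[where B = B])
         (auto elim!: eventually_mono dest: B)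
  qed
  have poly: "integral\<^sup>L F p = integral\<^sup>L G p" if "real_polynomial_function p" for p
    using real_polynomial_function_moments[OF int that, of "\<lambda>_. 1" 0] moments by simp
  show ?thesis
  proof (rule finite_borel_measure_eqI[OF \<open>finite_measure F\<close> \<open>finite_measure G\<close> sets])
    fix f :: "real^'d \<Rightarrow> real" assume f: "continuous_on UNIV f"
    \<comment> \<open>The sum of the total masses bounds the combined approximation error; adding 1
      keeps \<open>C\<close> positive when both measures vanish, so that \<open>e / C\<close> is an
      admissible accuracy.\<close>
    define C where "C = measure F (space F) + measure G (space G) + 1"
    have C: "C > 0" unfolding C_def by (simp add: add_nonneg_pos)
    have "\<bar>integral\<^sup>L F f - integral\<^sup>L G f\<bar> \<le> e" if "e > 0" for e
    proof -
      have "e / C > 0" using that C by simp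
      from Stone_Weierstrass_real_polynomial_function[OF compact_cbox[of 0 1] continuous_on_subset[OF f subset_UNIV] this]
      obtain p where p: "real_polynomial_function p" "\<And>x. x \<in> cbox 0 1 \<Longrightarrow> \<bar>f x - p x\<bar> < e / C"
        by blast
      have ip: "integrable F p \<and> integrable G p"
        using p(1) by (intro int) (auto intro: continuous_on_polymonial_function simp: real_polynomial_function_eq)
      have approx: "\<bar>integral\<^sup>L M f - integral\<^sup>L M p\<bar> \<le> measure M (space M) * (e / C)"
        if M: "finite_measure M" "integrable M f" "integrable M p" "AE x in M. x \<in> cbox 0 1" for M
      proof -
        interpret finite_measure M by fact
        have "\<bar>integral\<^sup>L M f - integral\<^sup>L M p\<bar> = \<bar>\<integral>x. f x - p x \<partial>M\<bar>"
          using M by simp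
        also have "\<dots> \<le> (\<integral>x. \<bar>f x - p x\<bar> \<partial>M)" by (rule integral_abs_bound)
        also have "\<dots> \<le> (\<integral>x. e / C \<partial>M)"
          using M by (intro integral_mono_AE) (auto elim!: eventually_mono dest!: p(2))
        finally show ?thesis by simp
      qed
      have "\<bar>integral\<^sup>L F f - integral\<^sup>L G f\<bar> \<le> measure F (space F) * (e / C) + measure G (space G) * (e / C)"
        using approx[OF \<open>finite_measure F\<close>] approx[OF \<open>finite_measure G\<close>] int[OF f] ip cube poly[OF p(1)]
        by fastforce
      also have "\<dots> = (C - 1) * (e / C)"
        unfolding distrib_right[symmetric] by (simp add: C_def)
      also have "\<dots> \<le> C * (e / C)"
        using \<open>e / C > 0\<close> by (intro mult_right_mono) auto
      finally show ?thesis using C by simp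
    qed
    then show "integral\<^sup>L F f = integral\<^sup>L G f"
      by (metis abs_le_zero_iff dense_ge eq_iff_diff_eq_0)
  qed
qed

section \<open>Recovering a measure from its integrals of
  \<open>1 - monom_at x \<alpha>\<close>\<close>

text \<open>The sets where \<open>f\<close> is at least \<open>1 / real (Suc n)\<close> have finite
  measure by Markov's inequality, and they exhaust the space because \<open>f\<close> is
  positive.\<close>

lemma sigma_finite_measure_of_integrable_pos:
  fixes f :: "'a \<Rightarrow> real"
  assumes f: "integrable M f" and pos: "\<And>x. x \<in> space M \<Longrightarrow> 0 < f x"
  shows "sigma_finite_measure M"
proof
  define A where "A n = {x \<in> space M. f x \<ge> 1 / real (Suc n)}" for n
  have [measurable]: "f \<in> borel_measurable M" using f by simp
  have "emeasure M (A n) \<noteq> \<infinity>" for n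
  proof -
    have "emeasure M (A n) \<le> (1 / (1 / real (Suc n))) * (\<integral>x. f x \<partial>M)"
      unfolding A_def using pos
      by (intro integral_Markov_inequality f) (auto intro!: AE_I2 less_imp_le)
    then show ?thesis by (auto simp: top_unique)
  qed
  moreover have "\<Union> (range A) = space M"
  proof -
    have "x \<in> \<Union> (range A)" if "x \<in> space M" for x
      using nat_approx_posE[OF pos[OF that]] that unfolding A_def by (auto intro: less_imp_le)
    then show ?thesis by (auto simp: A_def)
  qed
  moreover have "range A \<subseteq> sets M" unfolding A_def by auto
  ultimately show "\<exists>A. countable A \<and> A \<subseteq> sets M \<and> \<Union> A = space M \<and> (\<forall>a\<in>A. emeasure M a \<noteq> \<infinity>)"
    by (intro exI[of _ "range A"]) auto
qed

lemma space_punctured_cube: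
  assumes "sets M = sets (restrict_space borel punctured_cube)"
  shows "space M = (punctured_cube :: (real^'d::finite) set)"
  using sets_eq_imp_space_eq[OF assms] by (simp add: space_restrict_space)

lemma borel_measurable_on_punctured_cube:
  assumes "sets M = sets (restrict_space borel (punctured_cube :: (real^'d::finite) set))"
    and "f \<in> borel_measurable borel"
  shows "f \<in> borel_measurable M"
  using measurable_restrict_space1[OF assms(2)] by (subst measurable_cong_sets[OF assms(1) refl])

text \<open>Since \<open>monom_at x \<beta> * (1 - x $ i)\<close> equals \<open>(1 - monom_at x
  (\<beta> + 1 *s axis i 1)) - (1 - monom_at x \<beta>)\<close>, each summand is a difference of two
  integrable functions, even where the monomial itself is not integrable.\<close>

lemma levy_measure_moment:
  fixes M :: "(real^'d::finite) measure"
  assumes int: "\<And>\<alpha>. \<alpha> \<noteq> 0 \<Longrightarrow> integrable M (\<lambda>x. 1 - monom_at x \<alpha>)"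
  shows "integrable M (\<lambda>x. monom_at x \<beta> * (\<Sum>i\<in>UNIV. 1 - x $ i))" (is ?I)
    and "(\<integral>x. monom_at x \<beta> * (\<Sum>i\<in>UNIV. 1 - x $ i) \<partial>M) =
      (\<Sum>i\<in>UNIV. (\<integral>x. 1 - monom_at x (\<beta> + 1 *s axis i 1) \<partial>M) - (\<integral>x. 1 - monom_at x \<beta> \<partial>M))" (is ?E)
proof -
  have nz: "\<beta> + 1 *s axis i 1 \<noteq> 0" for i
    by (auto simp: vec_eq_iff axis_def intro!: exI[of _ i])
  \<comment> \<open>The hypothesis leaves out the exponent 0, where the integrand is identically
    0.\<close>
  have int0: "integrable M (\<lambda>x. 1 - monom_at x \<beta>)"
    using int by (cases "\<beta> = 0") simp_all
  have *: "(\<lambda>x. monom_at x \<beta> * (\<Sum>i\<in>UNIV. 1 - x $ i)) =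
      (\<lambda>x. \<Sum>i\<in>UNIV. (1 - monom_at x (\<beta> + 1 *s axis i 1)) - (1 - monom_at x \<beta>))"
    unfolding monom_at_add monom_at_axis by (simp add: sum_distrib_left algebra_simps)
  show ?I unfolding * by (intro Bochner_Integration.integrable_sum Bochner_Integration.integrable_diff int nz int0)
  show ?E unfolding * using int[OF nz] int0
    by (subst Bochner_Integration.integral_sum) (simp_all only: Bochner_Integration.integrable_diff Bochner_Integration.integral_diff)
qed

text \<open>The measures may be infinite near the point 1, so they are first multiplied by the
  weight \<open>w\<close>, which makes them finite. The moments of the weighted measures are
  determined by the given integrals, and \<open>w\<close> can be divided out because it is positive
  on the punctured cube.\<close>

lemma levy_measure_eqI:
  fixes M N :: "(real^'d::finite) measure"
  assumes sets: "sets M = sets (restrict_space borel punctured_cube)"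
      "sets N = sets (restrict_space borel punctured_cube)"
    and int: "\<And>\<alpha>. \<alpha> \<noteq> 0 \<Longrightarrow> integrable M (\<lambda>x. 1 - monom_at x \<alpha>)"
      "\<And>\<alpha>. \<alpha> \<noteq> 0 \<Longrightarrow> integrable N (\<lambda>x. 1 - monom_at x \<alpha>)"
    and eq: "\<And>\<alpha>. \<alpha> \<noteq> 0 \<Longrightarrow> (\<integral>x. 1 - monom_at x \<alpha> \<partial>M) = (\<integral>x. 1 - monom_at x \<alpha> \<partial>N)"
  shows "M = N"
proof -
  define w :: "real^'d \<Rightarrow> real" where "w x = (\<Sum>i\<in>UNIV. 1 - x $ i)" for x
  \<comment> \<open>The image under the inclusion turns a weighted measure on the punctured cube
    into a measure on all Borel sets, as \<open>measure_eqI_moments\<close> requires.\<close>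
  define F where "F K = distr (density K w) borel (\<lambda>x. x)" for K
  have w_cont: "continuous_on UNIV w" unfolding w_def by (intro continuous_intros)
  have w_nonneg: "0 \<le> w x" if "x \<in> cbox 0 1" for x
    using that unfolding w_def by (auto intro!: sum_nonneg simp: mem_unit_cbox)
  have w_pos: "0 < w x" if "x \<in> punctured_cube" for x
  proof -
    \<comment> \<open>All summands of \<open>w x\<close> are nonnegative on the cube, and a
      coordinate different from 1 gives a positive one.\<close>
    have "x \<noteq> 1" using that by simp
    then obtain i where "x $ i \<noteq> 1" unfolding vec_eq_iff by auto
    then show ?thesis
      using that unfolding w_def mem_unit_cbox
      by (intro sum_pos2[of _ i]) (auto simp: mem_unit_cbox less_le)
  qed
  have w_borel: "w \<in> borel_measurable borel"
    using w_cont by (rule borel_measurable_continuous_onI)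
  note w = borel_measurable_on_punctured_cube[OF _ w_borel]
    borel_measurable_on_punctured_cube[OF _ measurable_ident]
  have K: "finite_measure (F K)" "AE x in F K. x \<in> cbox 0 1"
      "(\<integral>x. monom_at x \<beta> \<partial>F K) = (\<integral>x. monom_at x \<beta> * w x \<partial>K)"
    if K: "sets K = sets (restrict_space borel punctured_cube)"
      "\<And>\<alpha>. \<alpha> \<noteq> 0 \<Longrightarrow> integrable K (\<lambda>x. 1 - monom_at x \<alpha>)" for K \<beta>
  proof -
    note [measurable] = w[OF K(1), unfolded id_def]
    have wnn: "AE x in K. 0 \<le> w x"
      using w_nonneg space_punctured_cube[OF K(1)] by (intro AE_I2) auto
    \<comment> \<open>The weight is the integrand of the moment of order 0; its integral is the
      total mass of \<open>F K\<close>.\<close>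
    have "integrable K w"
      using levy_measure_moment(1)[OF K(2), of 0] by (simp add: w_def[abs_def])
    then have "(\<integral>\<^sup>+x. w x \<partial>K) < \<infinity>"
      using nn_integral_eq_integral[OF _ wnn] by simp
    moreover have "emeasure (density K w) (space K) = (\<integral>\<^sup>+x. w x \<partial>K)"
      by (subst emeasure_density) (auto intro!: nn_integral_cong)
    ultimately have "finite_measure (density K w)"
      by (intro finite_measureI) simp
    then show "finite_measure (F K)"
      unfolding F_def by (rule finite_measure.finite_measure_distr) simp
    have "AE x in density K w. x \<in> cbox 0 1"
      using space_punctured_cube[OF K(1)] by (intro AE_I2) simp
    then show "AE x in F K. x \<in> cbox 0 1"
      unfolding F_def by (subst AE_distr_iff) simp_all
    have m: "(\<lambda>x. monom_at x \<beta>) \<in> borel_measurable K"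
      by (intro borel_measurable_on_punctured_cube[OF K(1)] monom_at_measurable)
    have "(\<integral>x. monom_at x \<beta> \<partial>F K) = (\<integral>x. monom_at x \<beta> \<partial>density K w)"
      unfolding F_def by (rule integral_distr) simp_all
    also have "\<dots> = (\<integral>x. w x *\<^sub>R monom_at x \<beta> \<partial>K)"
      using m w(1)[OF K(1)] wnn by (rule integral_density)
    finally show "(\<integral>x. monom_at x \<beta> \<partial>F K) = (\<integral>x. monom_at x \<beta> * w x \<partial>K)"
      by (simp add: mult.commute)
  qed
  have "(\<integral>x. monom_at x \<beta> \<partial>F M) = (\<integral>x. monom_at x \<beta> \<partial>F N)" for \<beta>
  proof -
    have "\<beta> + 1 *s axis i 1 \<noteq> 0" for i
      by (auto simp: vec_eq_iff axis_def intro!: exI[of _ i])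
    moreover have "(\<integral>x. 1 - monom_at x \<beta> \<partial>M) = (\<integral>x. 1 - monom_at x \<beta> \<partial>N)"
      by (cases "\<beta> = 0") (simp_all add: eq)
    ultimately show ?thesis
      using K(3)[OF sets(1) int(1), of \<beta>] K(3)[OF sets(2) int(2), of \<beta>]
        levy_measure_moment(2)[OF int(1), of \<beta>] levy_measure_moment(2)[OF int(2), of \<beta>]
      by (simp add: w_def eq)
  qed
  then have FMN: "F M = F N"
    using K[OF sets(1) int(1)] K[OF sets(2) int(2)]
    by (intro measure_eqI_moments) (auto simp: F_def)
  \<comment> \<open>Passing to \<open>F K\<close> loses nothing: the measurable sets of
    \<open>K\<close> are Borel subsets of the punctured cube, and each is its own preimage under the
    inclusion.\<close>
  have em: "emeasure (density K w) A = emeasure (F K) A"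
    if "sets K = sets (restrict_space borel punctured_cube)" "A \<in> sets K" for K A
  proof -
    note [measurable] = w[OF that(1), unfolded id_def]
    have "A \<in> sets borel" "A \<subseteq> punctured_cube"
      using that by (auto simp: sets_restrict_space_iff)
    then show ?thesis
      unfolding F_def using space_punctured_cube[OF that(1)] by (subst emeasure_distr) (auto simp: Int_absorb2)
  qed
  have "density M w = density N w"
    using em[OF sets(1)] em[OF sets(2)] FMN sets by (intro measure_eqI) auto
  \<comment> \<open>Applied to \<open>M\<close> and \<open>N\<close>, this undoes the
    weighting.\<close>
  moreover have "K = density (density K w) (\<lambda>x. ennreal (1 / w x))"
    if "sets K = sets (restrict_space borel punctured_cube)" for K
  proof -
    note [measurable] = w[OF that(1), unfolded id_def]
    have "density (density K w) (\<lambda>x. ennreal (1 / w x)) = density K (\<lambda>x. ennreal (w x) * ennreal (1 / w x))"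
      by (rule density_density_eq) auto
    also have "\<dots> = density K (\<lambda>x. 1)"
    proof (intro density_cong AE_I2)
      fix x assume "x \<in> space K"
      then have "0 < w x" using w_pos space_punctured_cube[OF that] by simp
      then show "ennreal (w x) * ennreal (1 / w x) = 1"
        by (simp add: ennreal_mult'[symmetric])
    qed auto
    finally show ?thesis by (simp add: density_1)
  qed
  ultimately show ?thesis using sets by metis
qed

section \<open>Finite sums of measures\<close>

lemma sets_sum_measures_on [simp]: "sets (sum_measures_on N M) = sets N"
  by (simp add: sum_measures_on_def sets.sigma_sets_eq sets.space_closed)

lemma space_sum_measures_on [simp]: "space (sum_measures_on N M) = space N"
  by (rule sets_eq_imp_space_eq) simp

text \<open>A set function passed to \<open>measure_of\<close> takes effect once it is known to be
  positive and countably additive. Countable additivity comes from interchanging the finite sum with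
  the series.\<close>

lemma emeasure_sum_measures_on:
  fixes N :: "'a measure" and M :: "'i::finite \<Rightarrow> 'a measure"
  assumes M: "\<And>i. sets (M i) = sets N" and A: "A \<in> sets N"
  shows "emeasure (sum_measures_on N M) A = (\<Sum>i\<in>UNIV. emeasure (M i) A)"
proof (rule emeasure_measure_of[OF sum_measures_on_def])
  show "sets N \<subseteq> Pow (space N)" by (rule sets.space_closed)
  show "A \<in> sets (sum_measures_on N M)" using A by simp
  show "positive (sets (sum_measures_on N M)) (\<lambda>A. \<Sum>i\<in>UNIV. emeasure (M i) A)"
    by (simp add: positive_def)
  show "countably_additive (sets (sum_measures_on N M)) (\<lambda>A. \<Sum>i\<in>UNIV. emeasure (M i) A)"
  proof (rule countably_additiveI)
    fix B :: "nat \<Rightarrow> 'a set"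
    assume "range B \<subseteq> sets (sum_measures_on N M)" "disjoint_family B"
    then have "(\<Sum>n. emeasure (M i) (B n)) = emeasure (M i) (\<Union>n. B n)" for i
      using M by (intro suminf_emeasure) auto
    then show "(\<Sum>n. \<Sum>i\<in>UNIV. emeasure (M i) (B n)) = (\<Sum>i\<in>UNIV. emeasure (M i) (\<Union>n. B n))"
      by (subst suminf_sum) auto
  qed
qed

text \<open>Induction over nonnegative measurable functions, starting from indicators. In the limit
  step the supremum passes through the finite sum because the integrals increase with
  \<open>n\<close> for every \<open>M i\<close>.\<close>

lemma nn_integral_sum_measures_on:
  assumes M: "\<And>i. sets (M i) = sets N" and f: "f \<in> borel_measurable N"
  shows "(\<integral>\<^sup>+x. f x \<partial>sum_measures_on N M) = (\<Sum>i\<in>UNIV. \<integral>\<^sup>+x. f x \<partial>M i)"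
  using f
proof (induction rule: borel_measurable_induct)
  case (cong f g)
  then show ?case
    using M[THEN sets_eq_imp_space_eq] by (simp cong: nn_integral_cong_simp)
next
  case (set A)
  then show ?case using M by (simp add: emeasure_sum_measures_on)
next
  case (mult u c)
  have "u \<in> borel_measurable (sum_measures_on N M)" "u \<in> borel_measurable (M i)" for i
    using mult M by (auto cong: measurable_cong_sets)
  then show ?case using mult by (simp add: nn_integral_cmult sum_distrib_left)
next
  case (add u v)
  have "u \<in> borel_measurable (sum_measures_on N M)" "u \<in> borel_measurable (M i)"
    "v \<in> borel_measurable (sum_measures_on N M)" "v \<in> borel_measurable (M i)" for i
    using add M by (auto cong: measurable_cong_sets)
  then show ?case using add by (simp add: nn_integral_add sum.distrib)
next
  case (seq U)
  have m: "U n \<in> borel_measurable (sum_measures_on N M)" "U n \<in> borel_measurable (M i)" for i n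
    using seq M by (auto cong: measurable_cong_sets)
  have mono: "incseq (\<lambda>n. \<integral>\<^sup>+x. U n x \<partial>M i)" for i
    using seq.hyps(3) by (auto simp: incseq_def le_fun_def intro!: nn_integral_mono)
  show ?case
    using seq.IH mono
    by (simp add: nn_integral_monotone_convergence_SUP[OF seq.hyps(3)] m SUP_apply image_comp
        ennreal_SUP_sum)
qed

text \<open>For nonnegative \<open>f\<close>, a finite value of the nonnegative integral yields both
  integrability and the value of the Bochner integral, so the preceding additivity suffices.\<close>

lemma integral_sum_measures_on:
  fixes f :: "'a \<Rightarrow> real"
  assumes M: "\<And>i. sets (M i) = sets N" and f: "f \<in> borel_measurable N"
    and nonneg: "\<And>x. x \<in> space N \<Longrightarrow> 0 \<le> f x"
    and int: "\<And>i. integrable (M i) f"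
  shows "integrable (sum_measures_on N M) f \<and>
    integral\<^sup>L (sum_measures_on N M) f = (\<Sum>i\<in>UNIV. integral\<^sup>L (M i) f)"
proof (rule nn_integral_eq_integrable[THEN iffD1])
  have sp: "space (M i) = space N" for i using M by (rule sets_eq_imp_space_eq)
  show "f \<in> borel_measurable (sum_measures_on N M)" using f by (auto cong: measurable_cong_sets)
  show "AE x in sum_measures_on N M. 0 \<le> f x" using nonneg by (intro AE_I2) auto
  show "0 \<le> (\<Sum>i\<in>UNIV. integral\<^sup>L (M i) f)"
    using nonneg sp by (intro sum_nonneg Bochner_Integration.integral_nonneg) auto
  have "(\<integral>\<^sup>+x. f x \<partial>M i) = ennreal (integral\<^sup>L (M i) f)" for i
    using nonneg sp by (intro nn_integral_eq_integral int AE_I2) auto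
  moreover have "0 \<le> integral\<^sup>L (M i) f" for i
    using nonneg sp by (intro Bochner_Integration.integral_nonneg) auto
  ultimately show "(\<integral>\<^sup>+x. f x \<partial>sum_measures_on N M) = ennreal (\<Sum>i\<in>UNIV. integral\<^sup>L (M i) f)"
    using M f by (subst nn_integral_sum_measures_on) auto
qed

section \<open>The product measures as images of the coordinate measures\<close>

lemma borel_measurable_vec_lambda:
  fixes f :: "'a \<Rightarrow> 'd::finite \<Rightarrow> real"
  assumes "\<And>j. (\<lambda>x. f x j) \<in> borel_measurable M"
  shows "(\<lambda>x. \<chi> j. f x j) \<in> borel_measurable M"
proof (subst borel_measurable_euclidean_space, intro ballI)
  fix b :: "real^'d" assume "b \<in> Basis"
  then obtain k where "b = axis k 1" by (auto simp: Basis_vec_def)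
  then show "(\<lambda>x. (\<chi> j. f x j) \<bullet> b) \<in> borel_measurable M"
    using assms[of k] by (simp add: inner_axis)
qed

text \<open>Used for the coordinate projections of the product space, whose factors carry the Borel
  sets of a subinterval and not those of the whole line.\<close>

lemma measurable_into_restrict_borel:
  assumes "f \<in> M \<rightarrow>\<^sub>M N" "sets N = sets (restrict_space borel S)"
  shows "f \<in> borel_measurable M"
proof -
  have "f \<in> M \<rightarrow>\<^sub>M restrict_space borel S"
    using assms measurable_cong_sets[OF refl assms(2)] by blast
  then show ?thesis by (simp add: measurable_restrict_space2_iff)
qed

text \<open>All factors other than the \<open>i\<close>-th are Dirac measures at 1, so the product
  is carried by the edge of the cube on which the other coordinates are 1, and it is the image of
  \<mu> under the parametrization \<open>T\<close> of that edge.\<close>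

lemma coord_product_eq_distr:
  fixes i :: "'d::finite" and \<mu> :: "real measure"
  assumes "sigma_finite_measure \<mu>" and sets: "sets \<mu> = sets (restrict_space borel {0..<1})"
  defines "T \<equiv> \<lambda>t. \<chi> j. if j = i then t else (1::real)"
  shows "T \<in> \<mu> \<rightarrow>\<^sub>M restrict_space borel punctured_cube"
    and "coord_product i \<mu> = distr \<mu> (restrict_space borel punctured_cube) T"
proof -
  define U :: "real measure" where "U = return (restrict_space borel {0..1}) 1"
  define M where "M j = (if j = i then \<mu> else U)" for j
  define P where "P t j = (if j = i then t else (1::real))" for t j
  have sp: "space \<mu> = {0..<1}" "space U = {0..1}"
    using sets_eq_imp_space_eq[OF sets] by (simp_all add: U_def space_restrict_space)
  have "sigma_finite_measure U"
    unfolding U_def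
    by (intro prob_space_imp_sigma_finite prob_space_return) (simp add: space_restrict_space)
  then interpret product_sigma_finite M
    using assms(1) by (simp add: product_sigma_finite_def M_def)
  have P: "P \<in> \<mu> \<rightarrow>\<^sub>M PiM UNIV M"
    unfolding P_def
  proof (rule measurable_PiM_single')
    show "(\<lambda>t. if j = i then t else 1) \<in> \<mu> \<rightarrow>\<^sub>M M j" for j
      using sp by (cases "j = i") (auto simp: M_def)
    show "(\<lambda>t j. if j = i then t else 1) \<in> space \<mu> \<rightarrow> (\<Pi>\<^sub>E j\<in>UNIV. space (M j))"
      using sp by (auto simp: M_def)
  qed
  \<comment> \<open>With sigma-finite factors the product measure is determined by its values on
    boxes, so only boxes are compared.\<close>
  have eq: "distr \<mu> (PiM UNIV M) P = PiM UNIV M"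
  proof (rule PiM_eqI)
    fix A assume A: "\<And>j. j \<in> UNIV \<Longrightarrow> A j \<in> sets (M j)"
    have Ai: "A i \<in> sets \<mu>" and Aj: "j \<noteq> i \<Longrightarrow> A j \<in> sets (restrict_space borel {0..1})" for j
      using A[of i] A[of j] by (simp_all add: M_def U_def)
    have "emeasure (distr \<mu> (PiM UNIV M) P) (Pi\<^sub>E UNIV A) = emeasure \<mu> (P -` Pi\<^sub>E UNIV A \<inter> space \<mu>)"
      using P A by (intro emeasure_distr sets_PiM_I_finite) auto
    \<comment> \<open>The point \<open>P t\<close> has all coordinates other than the
      \<open>i\<close>-th equal to 1, so it lies in the box only if every other side contains 1, and
      then exactly for \<open>t\<close> in \<open>A i\<close>.\<close>
    also have "P -` Pi\<^sub>E UNIV A \<inter> space \<mu> = (if \<forall>j. j \<noteq> i \<longrightarrow> 1 \<in> A j then A i else {})"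
      using sets.sets_into_space[OF Ai] by (auto simp: P_def PiE_iff split: if_splits)
    also have "emeasure \<mu> \<dots> = emeasure \<mu> (A i) * (\<Prod>j\<in>UNIV - {i}. indicator (A j) 1)"
      by (auto simp: prod_zero_iff indicator_def)
    also have "(\<Prod>j\<in>UNIV - {i}. indicator (A j) 1) = (\<Prod>j\<in>UNIV - {i}. emeasure (M j) (A j))"
      using Aj by (intro prod.cong) (auto simp: M_def U_def)
    also have "emeasure \<mu> (A i) * (\<Prod>j\<in>UNIV - {i}. emeasure (M j) (A j)) = (\<Prod>j\<in>UNIV. emeasure (M j) (A j))"
      by (subst (2) prod.remove[of _ i]) (auto simp: M_def)
    finally show "emeasure (distr \<mu> (PiM UNIV M) P) (Pi\<^sub>E UNIV A) = (\<Prod>j\<in>UNIV. emeasure (M j) (A j))" .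
  qed auto
  have V: "vec_lambda \<in> PiM UNIV M \<rightarrow>\<^sub>M restrict_space borel punctured_cube"
  proof (rule measurable_restrict_space2)
    show "vec_lambda \<in> space (PiM UNIV M) \<rightarrow> punctured_cube"
    proof
      fix x assume "x \<in> space (PiM UNIV M)"
      then have x: "x j \<in> space (M j)" for j by (auto simp: space_PiM)
      have "0 \<le> x j \<and> x j \<le> 1" for j
        using x[of j] by (auto simp: M_def sp split: if_splits)
      \<comment> \<open>The \<open>i\<close>-th coordinate lies in \<open>{0..<1}\<close>, which
        keeps the image away from the removed point.\<close>
      moreover have "vec_lambda x \<noteq> 1"
        using x[of i] by (auto simp: M_def sp vec_eq_iff intro!: exI[of _ i])
      ultimately show "vec_lambda x \<in> punctured_cube" by (simp add: mem_unit_cbox)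
    qed
    have Ms: "sets (M j) = sets (restrict_space borel (if j = i then {0..<1} else {0..1}))" for j
      by (simp add: M_def U_def sets)
    have "(\<lambda>x. x j) \<in> borel_measurable (PiM UNIV M)" for j
      by (rule measurable_into_restrict_borel[OF _ Ms[of j]]) simp
    then show "vec_lambda \<in> borel_measurable (PiM UNIV M)"
      by (rule borel_measurable_vec_lambda)
  qed
  have T: "T = vec_lambda \<circ> P" by (simp add: T_def P_def fun_eq_iff)
  show "T \<in> \<mu> \<rightarrow>\<^sub>M restrict_space borel punctured_cube"
    unfolding T using P V by (rule measurable_comp)
  have "coord_product i \<mu> = distr (PiM UNIV M) (restrict_space borel punctured_cube) vec_lambda"
    unfolding coord_product_def M_def[abs_def] U_def ..
  also have "\<dots> = distr \<mu> (restrict_space borel punctured_cube) T"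
    unfolding T by (subst eq[symmetric], rule distr_distr[OF V P])
  finally show "coord_product i \<mu> = distr \<mu> (restrict_space borel punctured_cube) T" .
qed

lemma borel_measurable_levy_integrand:
  "(\<lambda>x. 1 - monom_at x \<alpha>) \<in> borel_measurable (restrict_space borel punctured_cube)"
  by (intro measurable_restrict_space1) measurable

text \<open>Change of variables along the edge: where the other coordinates are 1, the monomial
  reduces to \<open>t ^ (\<alpha> $ i)\<close>.\<close>

lemma coord_product_integral:
  fixes i :: "'d::finite" and \<mu> :: "real measure"
  assumes "sigma_finite_measure \<mu>" and "sets \<mu> = sets (restrict_space borel {0..<1})"
    and "integrable \<mu> (\<lambda>t. 1 - t ^ (\<alpha> $ i))"
  shows "integrable (coord_product i \<mu>) (\<lambda>x. 1 - monom_at x \<alpha>)"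
    and "(\<integral>x. 1 - monom_at x \<alpha> \<partial>coord_product i \<mu>) = (\<integral>t. 1 - t ^ (\<alpha> $ i) \<partial>\<mu>)"
proof -
  note * = coord_product_eq_distr[OF assms(1,2), of i]
  have "monom_at (\<chi> j. if j = i then t else 1) \<alpha> = t ^ (\<alpha> $ i)" for t :: real
  proof -
    have "monom_at (\<chi> j. if j = i then t else 1) \<alpha> = (\<Prod>j\<in>UNIV. if j = i then t ^ (\<alpha> $ i) else 1)"
      unfolding monom_at_def by (intro prod.cong) auto
    then show ?thesis by simp
  qed
  then show "integrable (coord_product i \<mu>) (\<lambda>x. 1 - monom_at x \<alpha>)"
    and "(\<integral>x. 1 - monom_at x \<alpha> \<partial>coord_product i \<mu>) = (\<integral>t. 1 - t ^ (\<alpha> $ i) \<partial>\<mu>)"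
    using assms(3) unfolding *(2)
    by (simp_all add: integrable_distr_eq[OF *(1) borel_measurable_levy_integrand]
        integral_distr[OF *(1) borel_measurable_levy_integrand])
qed

section \<open>Consequences of the Levy representation\<close>

text \<open>The integral formula extends to \<alpha> = 0, since \<open>b 0 = 0\<close> by additivity
  and the integrand vanishes there. This spares later case distinctions.\<close>

lemma levy_tripleD:
  assumes "levy_triple \<phi> a b \<nu>"
  shows "sets \<nu> = sets (restrict_space borel punctured_cube)"
    and "b (\<alpha> + \<beta>) = b \<alpha> + b \<beta>" and "b 0 = 0"
    and "integrable \<nu> (\<lambda>x. 1 - monom_at x \<alpha>)"
    and "\<phi> \<alpha> = \<phi> 0 + b \<alpha> + (\<integral>x. 1 - monom_at x \<alpha> \<partial>\<nu>)"
    and "(\<lambda>n. \<phi> (n *s \<alpha>) / real n) \<longlonglongrightarrow> b \<alpha>"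
proof -
  show add: "b (\<alpha> + \<beta>) = b \<alpha> + b \<beta>" for \<alpha> \<beta>
    using assms by (simp add: levy_triple_def)
  show b0: "b 0 = 0" using add[of 0 0] by simp
  show "integrable \<nu> (\<lambda>x. 1 - monom_at x \<alpha>)"
    and "\<phi> \<alpha> = \<phi> 0 + b \<alpha> + (\<integral>x. 1 - monom_at x \<alpha> \<partial>\<nu>)"
    using assms b0 by (cases "\<alpha> = 0"; simp add: levy_triple_def)+
qed (use assms in \<open>simp_all add: levy_triple_def radon_measure_on_def\<close>)

text \<open>The map \<open>vec\<close> carries the half-open interval into the punctured cube of
  \<open>real^1\<close> and turns \<open>monom_at\<close> into an ordinary power, so the
  representation on \<open>nat^1\<close> becomes one on \<open>nat\<close> by change of
  variables.\<close>

lemma levy_measure_natD: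
  assumes "levy_measure_nat f \<mu>"
  obtains b where "\<And>n. integrable \<mu> (\<lambda>t. 1 - t ^ n)"
    and "\<And>n. f n = f 0 + b n + (\<integral>t. 1 - t ^ n \<partial>\<mu>)"
    and "\<And>n. (\<lambda>k. f (k * n) / real k) \<longlonglongrightarrow> b n"
proof -
  have sets: "sets \<mu> = sets (restrict_space borel {0..<1})"
    using assms by (simp add: levy_measure_nat_def)
  have sp: "space \<mu> = {0..<1}"
    using sets_eq_imp_space_eq[OF sets] by (simp add: space_restrict_space)
  have "(\<lambda>t. t) \<in> borel_measurable \<mu>"
    using measurable_into_restrict_borel[OF measurable_ident sets] by (simp add: id_def)
  then have v: "(vec :: real \<Rightarrow> real^1) \<in> \<mu> \<rightarrow>\<^sub>M restrict_space borel punctured_cube"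
    using sp unfolding vec_def
    by (intro measurable_restrict_space2 borel_measurable_vec_lambda) (auto simp: mem_unit_cbox vec_eq_iff)
  obtain a b where b: "levy_triple (\<lambda>\<alpha>::nat^1. f (\<alpha> $ 1)) a b
      (distr \<mu> (restrict_space borel punctured_cube) vec)"
    using assms by (auto simp: levy_measure_nat_def levy_measure_def)
  have m: "monom_at (vec t :: real^1) (vec n) = t ^ n" for t n
    by (simp add: monom_at_def UNIV_1)
  have s: "k *s vec n = (vec (k * n) :: nat^1)" for k n :: nat by (simp add: vec_eq_iff)
  show ?thesis
  proof (rule that[of "\<lambda>n. b (vec n)"])
    fix n
    show "integrable \<mu> (\<lambda>t. 1 - t ^ n)"
      using levy_tripleD(4)[OF b, of "vec n"]
      by (simp add: integrable_distr_eq[OF v borel_measurable_levy_integrand] m)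
    show "f n = f 0 + b (vec n) + (\<integral>t. 1 - t ^ n \<partial>\<mu>)"
      using levy_tripleD(5)[OF b, of "vec n"]
      by (simp add: integral_distr[OF v borel_measurable_levy_integrand] m)
    show "(\<lambda>k. f (k * n) / real k) \<longlonglongrightarrow> b (vec n)"
      using levy_tripleD(6)[OF b, of "vec n"] by (simp add: s)
  qed
qed

section \<open>Additivity over the coordinates and the form of the Levy measure\<close>

theorem theorem2p2:
  fixes \<phi> :: "nat^'d::finite \<Rightarrow> real"
    and \<nu> :: "(real^'d) measure"
    and \<nu>c :: "'d \<Rightarrow> real measure"
  assumes "completely_alternating \<phi>"
    and "levy_measure \<phi> \<nu>"
    and "\<And>i. levy_measure_nat (coord_fun \<phi> i) (\<nu>c i)"
  shows "(\<forall>\<alpha>. \<phi> \<alpha> = (\<Sum>i\<in>UNIV. coord_fun \<phi> i (\<alpha> $ i)) - (real CARD('d) - 1) * \<phi> 0)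
     \<longleftrightarrow> \<nu> = sum_measures_on (restrict_space borel punctured_cube)
               (\<lambda>i. coord_product i (\<nu>c i))"
proof -
  define \<sigma> where "\<sigma> = sum_measures_on (restrict_space borel punctured_cube)
               (\<lambda>i. coord_product i (\<nu>c i))"
  obtain a b where b: "levy_triple \<phi> a b \<nu>"
    using assms(2) by (auto simp: levy_measure_def)
  have "\<exists>c. (\<forall>n. integrable (\<nu>c i) (\<lambda>t. 1 - t ^ n)) \<and>
      (\<forall>n. coord_fun \<phi> i n = coord_fun \<phi> i 0 + c n + (\<integral>t. 1 - t ^ n \<partial>\<nu>c i)) \<and>
      (\<forall>n. (\<lambda>k. coord_fun \<phi> i (k * n) / real k) \<longlonglongrightarrow> c n)" for i
    by (rule levy_measure_natD[OF assms(3)[of i]]) blast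
  then obtain c where c: "\<And>i n. integrable (\<nu>c i) (\<lambda>t. 1 - t ^ n)"
      "\<And>i n. coord_fun \<phi> i n = coord_fun \<phi> i 0 + c i n + (\<integral>t. 1 - t ^ n \<partial>\<nu>c i)"
      "\<And>i n. (\<lambda>k. coord_fun \<phi> i (k * n) / real k) \<longlonglongrightarrow> c i n"
    by metis
  have cs: "sets (\<nu>c i) = sets (restrict_space borel {0..<1})" for i
    using assms(3)[of i] by (simp add: levy_measure_nat_def)
  \<comment> \<open>The function \<open>1 - t\<close> is positive on \<open>{0..<1}\<close> and
    integrable, being the Levy integrand for \<open>n = 1\<close>.\<close>
  have sf: "sigma_finite_measure (\<nu>c i)" for i
    using c(1)[of i 1] sets_eq_imp_space_eq[OF cs[of i]]
    by (intro sigma_finite_measure_of_integrable_pos[of _ "\<lambda>t. 1 - t"]) (auto simp: space_restrict_space)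
  \<comment> \<open>Both sides are the limit of the same sequence, because
    \<open>coord_fun \<phi> i (k * n)\<close> is \<phi> at
    \<open>k *s (n *s axis i 1)\<close>.\<close>
  have bc: "b (n *s axis i 1) = c i n" for i n
  proof (rule LIMSEQ_unique)
    show "(\<lambda>k. \<phi> (k *s (n *s axis i 1)) / real k) \<longlonglongrightarrow> b (n *s axis i 1)"
      by (rule levy_tripleD(6)[OF b])
    show "(\<lambda>k. \<phi> (k *s (n *s axis i 1)) / real k) \<longlonglongrightarrow> c i n"
      using c(3)[of i n] by (simp add: coord_fun_def vector_smult_assoc)
  qed
  have bsum: "b (\<Sum>i\<in>I. g i) = (\<Sum>i\<in>I. b (g i))" if "finite I" for I and g :: "'d \<Rightarrow> nat^'d"
    using that by (induction I rule: finite_induct) (simp_all add: levy_tripleD(2,3)[OF b])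
  have b_eq: "b \<alpha> = (\<Sum>i\<in>UNIV. c i (\<alpha> $ i))" for \<alpha>
  proof -
    have "\<alpha> = (\<Sum>i\<in>UNIV. \<alpha> $ i *s axis i 1)"
      by (simp add: vec_eq_iff axis_def if_distrib[of "times _"] cong: if_cong)
    then have "b \<alpha> = b (\<Sum>i\<in>UNIV. \<alpha> $ i *s axis i 1)" by (rule arg_cong)
    then show ?thesis unfolding bsum[OF finite] bc .
  qed
  have \<sigma>: "integrable \<sigma> (\<lambda>x. 1 - monom_at x \<alpha>) \<and>
      (\<integral>x. 1 - monom_at x \<alpha> \<partial>\<sigma>) = (\<Sum>i\<in>UNIV. \<integral>t. 1 - t ^ (\<alpha> $ i) \<partial>\<nu>c i)" for \<alpha>
  proof -
    have "integrable \<sigma> (\<lambda>x. 1 - monom_at x \<alpha>) \<and> (\<integral>x. 1 - monom_at x \<alpha> \<partial>\<sigma>) =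
        (\<Sum>i\<in>UNIV. \<integral>x. 1 - monom_at x \<alpha> \<partial>coord_product i (\<nu>c i))"
      unfolding \<sigma>_def
    proof (rule integral_sum_measures_on)
      show "sets (coord_product i (\<nu>c i)) = sets (restrict_space borel punctured_cube)" for i
        by (simp add: coord_product_def)
      show "0 \<le> 1 - monom_at x \<alpha>"
        if "x \<in> space (restrict_space borel punctured_cube)" for x :: "real^'d"
        using that monom_at_unit(2)[of x \<alpha>] by (simp add: space_restrict_space)
    qed (rule borel_measurable_levy_integrand coord_product_integral sf cs c(1))+
    then show ?thesis
      by (simp add: coord_product_integral[OF sf cs c(1)])
  qed
  \<comment> \<open>Expanding both sides by their Levy representations, the constants agree because
    \<open>CARD('d)\<close> copies of \<open>\<phi> 0\<close> are reduced to one, and the linear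
    parts agree by \<open>b_eq\<close>. Only the two integrals remain, for each \<alpha>
    separately.\<close>
  have iff: "\<phi> \<alpha> = (\<Sum>i\<in>UNIV. coord_fun \<phi> i (\<alpha> $ i)) - (real CARD('d) - 1) * \<phi> 0 \<longleftrightarrow>
      (\<integral>x. 1 - monom_at x \<alpha> \<partial>\<nu>) = (\<integral>x. 1 - monom_at x \<alpha> \<partial>\<sigma>)" for \<alpha>
  proof -
    have "coord_fun \<phi> i 0 = \<phi> 0" for i by (simp add: coord_fun_def)
    then have "(\<Sum>i\<in>UNIV. coord_fun \<phi> i (\<alpha> $ i)) =
        (\<Sum>i\<in>UNIV. \<phi> 0 + c i (\<alpha> $ i) + (\<integral>t. 1 - t ^ (\<alpha> $ i) \<partial>\<nu>c i))"
      by (subst c(2)) (simp only:)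
    then have "(\<Sum>i\<in>UNIV. coord_fun \<phi> i (\<alpha> $ i)) =
        real CARD('d) * \<phi> 0 + b \<alpha> + (\<integral>x. 1 - monom_at x \<alpha> \<partial>\<sigma>)"
      using \<sigma>[of \<alpha>] by (simp add: b_eq sum.distrib)
    then show ?thesis using levy_tripleD(5)[OF b, of \<alpha>] by (simp add: algebra_simps)
  qed
  \<comment> \<open>Equality of the integrals for all \<alpha> forces equality of the measures by
    \<open>levy_measure_eqI\<close>; the converse is immediate.\<close>
  have "(\<forall>\<alpha>. (\<integral>x. 1 - monom_at x \<alpha> \<partial>\<nu>) = (\<integral>x. 1 - monom_at x \<alpha> \<partial>\<sigma>)) \<longleftrightarrow> \<nu> = \<sigma>"
    using levy_measure_eqI[of \<nu> \<sigma>] levy_tripleD(1,4)[OF b] \<sigma> by (auto simp: \<sigma>_def)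
  then show ?thesis unfolding iff \<sigma>_def .
qed

end
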